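(* Let $a,b,c,d,e$ be circles in the plane. If $acd \to e$ and $bcd \to e$ are both tight implications, then the implication $ab \to e$ does not hold.
   Context: A circle means a closed disc in $\mathbb{R}^2$ (boundary included), possibly of radius $0$; a circle is identified with its point set. For a set $Y$ of circles (written as a word), $\mathrm{CH}(Y)$ is the convex hull of the union of their point sets, and the implication $Y\to u$ means $u\subseteq \mathrm{CH}(Y)$. It is tight if it holds and $u\not\subseteq\mathrm{CH}(Y\setminus\{z\})$ for every $z\in Y$. *)

theory Defs
  imports "HOL-Analysis.Analysis"
begin

text \<open>A circle is a closed disc of the plane, identified with its point set.
  Radius 0 is allowed; negative radii are excluded because then \<open>cball\<close> is empty.\<close>

definition is_circle :: "(real ^ 2) set \<Rightarrow> bool" where
  "is_circle u \<longleftrightarrow> (\<exists>x r. 0 \<le> r \<and> u = cball x r)"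

definition CH :: "(real ^ 2) set set \<Rightarrow> (real ^ 2) set" where
  "CH Y = convex hull (\<Union>Y)"

definition implication :: "(real ^ 2) set set \<Rightarrow> (real ^ 2) set \<Rightarrow> bool" where
  "implication Y u \<longleftrightarrow> u \<subseteq> CH Y"

definition tight_implication :: "(real ^ 2) set set \<Rightarrow> (real ^ 2) set \<Rightarrow> bool" where
  "tight_implication Y u \<longleftrightarrow> implication Y u \<and> (\<forall>z\<in>Y. \<not> u \<subseteq> CH (Y - {z}))"

end

theory Submission
  imports Defs
begin

text \<open>For a disc \<open>y\<close> let \<open>N y\<close> be the set of unit vectors in whose direction \<open>e\<close> reaches strictly
  further than \<open>y\<close>. Comparing support functions, \<open>N y\<close> is the part of the unit circle in an open
  half-plane, hence an arc, and \<open>Y \<rightarrow> e\<close> holds iff the arcs of the members of \<open>Y\<close> have no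
  common point. So tightness of \<open>acd \<rightarrow> e\<close> says that \<open>N a\<close>, \<open>N c\<close>, \<open>N d\<close> meet pairwise but
  not all together. By Helly's theorem on the line, three such arcs cover the circle; by
  connectedness of \<open>N a\<close>, the arcs \<open>N c\<close> and \<open>N d\<close> alone do not. A point outside
  \<open>N c \<union> N d\<close> therefore lies in \<open>N a\<close>, and likewise in \<open>N b\<close>.\<close>

section \<open>Stereographic projection of arcs\<close>

text \<open>Stereographic projection from a point outside an arc turns the linear inequality defining the
  arc into a quadratic one with nonnegative leading coefficient.\<close>
lemma stereographic_arc:
  fixes w :: "real ^ 2"
  assumes "norm w = 1"
  obtains \<phi> :: "real \<Rightarrow> real ^ 2"
  where "continuous_on UNIV \<phi>" "range \<phi> = sphere 0 1 - {w}"
    "\<And>p q. q \<le> p \<bullet> w \<Longrightarrow> is_interval {t. p \<bullet> \<phi> t < q}"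
proof
  \<comment> \<open>A quarter turn of \<open>w\<close>, so that \<open>w\<close>, \<open>v\<close>
    is an orthonormal basis.\<close>
  define v :: "real ^ 2" where "v = vector [- (w $ 2), w $ 1]"
  \<comment> \<open>The second point in which the line through \<open>w\<close> and
    \<open>t *\<^sub>R v\<close> meets the unit circle.\<close>
  define \<phi> where "\<phi> t = (1 / (1 + t\<^sup>2)) *\<^sub>R ((t\<^sup>2 - 1) *\<^sub>R w + (2 * t) *\<^sub>R v)" for t
  have pos: "1 + t\<^sup>2 > 0" for t :: real
    by (simp add: add_pos_nonneg)
  have ww: "(w $ 1)\<^sup>2 + (w $ 2)\<^sup>2 = 1"
    using assms by (simp add: norm_eq_1 inner_vec_def sum_2 power2_eq_square)
  have orth: "w \<bullet> w = 1" "v \<bullet> v = 1" "w \<bullet> v = 0" "v \<bullet> w = 0"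
    using ww by (simp_all add: v_def inner_vec_def sum_2 power2_eq_square)
  have decomp: "u = (u \<bullet> w) *\<^sub>R w + (u \<bullet> v) *\<^sub>R v" for u
  proof -
    have "u $ 1 = (u $ 1 * w $ 1 + u $ 2 * w $ 2) * w $ 1 - (u $ 2 * w $ 1 - u $ 1 * w $ 2) * w $ 2"
      using ww by algebra
    moreover have "u $ 2 = (u $ 1 * w $ 1 + u $ 2 * w $ 2) * w $ 2 + (u $ 2 * w $ 1 - u $ 1 * w $ 2) * w $ 1"
      using ww by algebra
    ultimately show ?thesis
      by (simp add: vec_eq_iff forall_2 v_def inner_vec_def sum_2)
  qed
  show "continuous_on UNIV \<phi>"
    unfolding \<phi>_def using pos by (intro continuous_intros) (metis less_irrefl)
  show "range \<phi> = sphere 0 1 - {w}"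
  proof (intro subset_antisym subsetI)
    fix u assume "u \<in> range \<phi>"
    then obtain t where u: "u = \<phi> t" by blast
    have "u \<bullet> w = (t\<^sup>2 - 1) / (1 + t\<^sup>2)"
      by (simp add: u \<phi>_def inner_add_left orth)
    then have "u \<bullet> w \<noteq> 1"
      using pos[of t] by (auto simp: divide_eq_1_iff)
    have "u \<bullet> u = ((t\<^sup>2 - 1)\<^sup>2 + (2 * t)\<^sup>2) / (1 + t\<^sup>2)\<^sup>2"
      by (simp add: u \<phi>_def inner_add_left inner_add_right orth power2_eq_square add_divide_distrib)
    also have "(t\<^sup>2 - 1)\<^sup>2 + (2 * t)\<^sup>2 = (1 + t\<^sup>2)\<^sup>2" by algebra
    finally have "u \<bullet> u = 1"
      using pos[of t] by simp
    with \<open>u \<bullet> w \<noteq> 1\<close> show "u \<in> sphere 0 1 - {w}"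
      using orth by (auto simp: norm_eq_1)
  next
    fix u assume u: "u \<in> sphere 0 1 - {w}"
    define x y where "x = u \<bullet> w" and "y = u \<bullet> v"
    have uxy: "u = x *\<^sub>R w + y *\<^sub>R v"
      unfolding x_def y_def by (rule decomp)
    have "u \<bullet> u = 1" using u by (simp add: norm_eq_1)
    then have sq: "x\<^sup>2 + y\<^sup>2 = 1"
      by (simp add: uxy inner_add_left inner_add_right orth power2_eq_square)
    have "x \<noteq> 1"
      using u uxy sq by auto
    \<comment> \<open>The line from \<open>w\<close> through \<open>u\<close> meets the axis spanned
      by \<open>v\<close> at this parameter.\<close>
    define t where "t = y / (1 - x)"
    have y: "y = t * (1 - x)"
      using \<open>x \<noteq> 1\<close> by (simp add: t_def)
    have "(1 - x) * (1 + x - t\<^sup>2 * (1 - x)) = 0"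
      using sq unfolding y by algebra
    then have t2: "t\<^sup>2 * (1 - x) = 1 + x"
      using \<open>x \<noteq> 1\<close> by simp
    have "(t\<^sup>2 - 1) / (1 + t\<^sup>2) = x" "2 * t / (1 + t\<^sup>2) = y"
      using pos[of t] t2 y by (simp_all add: divide_eq_eq) algebra+
    then have "u = \<phi> t"
      by (simp add: uxy \<phi>_def scaleR_add_right)
    then show "u \<in> range \<phi>" by blast
  qed
  fix p :: "real ^ 2" and q :: real
  assume "q \<le> p \<bullet> w"
  \<comment> \<open>Coefficients after clearing the denominator; \<open>A \<ge> 0\<close> says
    exactly that \<open>w\<close> lies off the arc.\<close>
  define A B C where "A = p \<bullet> w - q" and "B = 2 * (p \<bullet> v)" and "C = - (p \<bullet> w + q)"
  have quadratic: "p \<bullet> \<phi> t < q \<longleftrightarrow> A * t\<^sup>2 + B * t + C < 0" for t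
  proof -
    have "p \<bullet> \<phi> t = ((t\<^sup>2 - 1) * (p \<bullet> w) + 2 * t * (p \<bullet> v)) / (1 + t\<^sup>2)"
      by (simp add: \<phi>_def inner_add_right add_divide_distrib)
    then show ?thesis
      by (simp add: pos_divide_less_eq[OF pos] A_def B_def C_def algebra_simps)
  qed
  have "A \<ge> 0" using \<open>q \<le> p \<bullet> w\<close> by (simp add: A_def)
  have "A * t\<^sup>2 + B * t + C < 0"
    if "A * x\<^sup>2 + B * x + C < 0" "A * y\<^sup>2 + B * y + C < 0" "x \<le> t" "t \<le> y" for x y t
  proof (cases "x = y")
    case False
    define l where "l = (t - x) / (y - x)"
    define k where "k = 1 - l"
    have "l * (y - x) = t - x" using False by (simp add: l_def)
    then have "t = k * x + l * y" by (simp add: k_def algebra_simps)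
    moreover have "0 \<le> l" "l \<le> 1" using that False by (simp_all add: l_def)
    ultimately have kl: "k \<ge> 0" "l \<ge> 0" "k + l = 1" "t = k * x + l * y" "l = 1 - k"
      by (simp_all add: k_def)
    have "k * l * (x - y)\<^sup>2 * A \<ge> 0"
      using kl \<open>A \<ge> 0\<close> by simp
    \<comment> \<open>Convexity of the quadratic, with its exact defect.\<close>
    moreover have "A * t\<^sup>2 + B * t + C = k * (A * x\<^sup>2 + B * x + C) + l * (A * y\<^sup>2 + B * y + C) - k * l * (x - y)\<^sup>2 * A"
      unfolding kl(4) kl(5) by algebra
    moreover have "k * (A * x\<^sup>2 + B * x + C) + l * (A * y\<^sup>2 + B * y + C) < 0"
      using convex_bound_lt[OF that(1,2) kl(1-3)] .
    ultimately show ?thesis by linarith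
  qed (use that in auto)
  then show "is_interval {t. p \<bullet> \<phi> t < q}"
    unfolding is_interval_1 quadratic by blast
qed

section \<open>Intersection patterns of arcs\<close>

text \<open>Degenerate cases are included on purpose: \<open>p = 0\<close>, which comes from
  concentric discs, gives the empty set or the whole circle.\<close>

definition arc_of :: "real ^ 2 \<Rightarrow> real \<Rightarrow> (real ^ 2) set" where
  "arc_of p q = {u \<in> sphere 0 1. p \<bullet> u < q}"

text \<open>Projecting from a point missed by all three arcs would turn them into pairwise meeting
  intervals, which share a point by Helly's theorem on the line.\<close>

lemma arcs_cover:
  assumes arcs: "A = arc_of pa qa" "C = arc_of pc qc" "D = arc_of pd qd"
    and meet: "A \<inter> C \<noteq> {}" "A \<inter> D \<noteq> {}" "C \<inter> D \<noteq> {}"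
    and empty: "A \<inter> C \<inter> D = {}"
  shows "sphere 0 1 \<subseteq> A \<union> C \<union> D"
proof (rule ccontr)
  assume "\<not> ?thesis"
  then obtain w where w: "norm w = 1" "w \<notin> A" "w \<notin> C" "w \<notin> D" by fastforce
  obtain \<phi> :: "real \<Rightarrow> real ^ 2" where "continuous_on UNIV \<phi>" and \<phi>: "range \<phi> = sphere 0 1 - {w}"
    "\<And>p q. q \<le> p \<bullet> w \<Longrightarrow> is_interval {t. p \<bullet> \<phi> t < q}"
    by (rule stereographic_arc[OF w(1)], rule that)
  have on: "norm (\<phi> t) = 1" for t
    using \<phi>(1) by (metis DiffD1 mem_sphere_0 rangeI)
  have interval: "s \<in> \<phi> -` X"
    if "X = arc_of p q" "w \<notin> X" "x \<in> \<phi> -` X" "y \<in> \<phi> -` X" "x \<le> s" "s \<le> y" for X p q x y s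
  proof -
    have "is_interval {t. p \<bullet> \<phi> t < q}"
      using \<phi>(2) that w(1) by (simp add: arc_of_def)
    moreover have "\<phi> -` X = {t. p \<bullet> \<phi> t < q}"
      using on that(1) by (auto simp: arc_of_def)
    ultimately show ?thesis
      using that(3-) unfolding is_interval_1 by blast
  qed
  have lift: "\<exists>t. t \<in> \<phi> -` X \<and> t \<in> \<phi> -` Y"
    if "X \<inter> Y \<noteq> {}" "X = arc_of p q" "w \<notin> X" for X Y p q
  proof -
    from that(1) obtain u where u: "u \<in> X" "u \<in> Y" by blast
    then have "u \<in> range \<phi>"
      using that(2,3) \<phi>(1) by (auto simp: arc_of_def)
    with u show ?thesis by blast
  qed
  obtain x y z where xyz: "x \<in> \<phi> -` A" "x \<in> \<phi> -` C" "y \<in> \<phi> -` A" "y \<in> \<phi> -` D"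
    "z \<in> \<phi> -` C" "z \<in> \<phi> -` D"
    using lift[OF meet(1) arcs(1) w(2)] lift[OF meet(2) arcs(1) w(2)] lift[OF meet(3) arcs(2) w(3)]
    by blast
  note I = interval[OF arcs(1) w(2)] interval[OF arcs(2) w(3)] interval[OF arcs(3) w(4)]
  \<comment> \<open>The middle one of \<open>x\<close>, \<open>y\<close>, \<open>z\<close> lies in
    two of the intervals by choice, and in the third because the outer two points do.\<close>
  have "\<exists>t. t \<in> \<phi> -` A \<and> t \<in> \<phi> -` C \<and> t \<in> \<phi> -` D"
    using I xyz by (meson linear)
  then show False using empty by blast
qed

text \<open>Otherwise \<open>C\<close> and \<open>D\<close> would cut the connected arc
  \<open>A\<close> into two nonempty, disjoint, relatively open pieces.\<close>

lemma two_arcs_not_cover: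
  assumes arcs: "A = arc_of pa qa" "C = arc_of pc qc" "D = arc_of pd qd"
    and meet: "A \<inter> C \<noteq> {}" "A \<inter> D \<noteq> {}" "C \<inter> D \<noteq> {}"
    and empty: "A \<inter> C \<inter> D = {}"
  shows "\<not> sphere 0 1 \<subseteq> C \<union> D"
proof
  assume cover: "sphere 0 1 \<subseteq> C \<union> D"
  have sub: "A \<subseteq> sphere 0 1" "C \<subseteq> sphere 0 1"
    by (auto simp: arcs arc_of_def)
  \<comment> \<open>Any point of \<open>C \<inter> D\<close> serves; projecting from it shows that
    \<open>A\<close> is a continuous image of an interval.\<close>
  then obtain w where w: "norm w = 1" "w \<notin> A"
    using meet(3) empty by fastforce
  obtain \<phi> :: "real \<Rightarrow> real ^ 2" where \<phi>: "continuous_on UNIV \<phi>" "range \<phi> = sphere 0 1 - {w}"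
    "\<And>p q. q \<le> p \<bullet> w \<Longrightarrow> is_interval {t. p \<bullet> \<phi> t < q}"
    by (rule stereographic_arc[OF w(1)], rule that)
  have "is_interval {t. pa \<bullet> \<phi> t < qa}"
    using \<phi>(3) w by (simp add: arcs arc_of_def)
  moreover have "A = range \<phi> \<inter> {u. pa \<bullet> u < qa}"
    using w(2) unfolding \<phi>(2) arcs arc_of_def by blast
  then have "A = \<phi> ` {t. pa \<bullet> \<phi> t < qa}" by blast
  ultimately have "connected A"
    using \<phi>(1) by (metis connected_continuous_image continuous_on_subset is_interval_connected top_greatest)
  define C' D' where "C' = {u. pc \<bullet> u < qc}" and "D' = {u. pd \<bullet> u < qd}"
  have "open C'" "open D'"
    by (simp_all add: C'_def D'_def open_halfspace_lt)
  moreover have "C = sphere 0 1 \<inter> C'" "D = sphere 0 1 \<inter> D'"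
    by (auto simp: arcs arc_of_def C'_def D'_def)
  ultimately show False
    using connectedD[OF \<open>connected A\<close>, of C' D'] meet empty cover sub by blast
qed

lemma arcs_meet:
  assumes arcs: "A = arc_of pa qa" "B = arc_of pb qb" "C = arc_of pc qc" "D = arc_of pd qd"
    and "A \<inter> C \<noteq> {}" "A \<inter> D \<noteq> {}" "B \<inter> C \<noteq> {}" "B \<inter> D \<noteq> {}" "C \<inter> D \<noteq> {}"
    and "A \<inter> C \<inter> D = {}" "B \<inter> C \<inter> D = {}"
  shows "A \<inter> B \<noteq> {}"
  using arcs_cover[OF arcs(1,3,4)] arcs_cover[OF arcs(2,3,4)] two_arcs_not_cover[OF arcs(1,3,4)]
    assms(5-) by blast

section \<open>Discs, hulls and support functions\<close>

text \<open>In a direction \<open>u\<close> as described, the extreme point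
  \<open>x + r *\<^sub>R u\<close> escapes the hull. Conversely, the hull is compact, so a point of
  the disc outside it can be strictly separated from it.\<close>

lemma cball_subset_CH_iff:
  assumes "finite Y" "\<And>y. y \<in> Y \<Longrightarrow> compact y" "0 \<le> r"
  shows "cball x r \<subseteq> CH Y \<longleftrightarrow>
    (\<nexists>u. norm u = 1 \<and> (\<forall>y\<in>Y. y \<subseteq> {z. u \<bullet> z < u \<bullet> x + r}))"
proof (intro iffI notI)
  assume sub: "cball x r \<subseteq> CH Y"
    and "\<exists>u. norm u = 1 \<and> (\<forall>y\<in>Y. y \<subseteq> {z. u \<bullet> z < u \<bullet> x + r})"
  then obtain u where u: "norm u = 1" "\<Union>Y \<subseteq> {z. u \<bullet> z < u \<bullet> x + r}" by blast
  have "CH Y \<subseteq> {z. u \<bullet> z < u \<bullet> x + r}"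
    unfolding CH_def using u(2) by (intro hull_minimal convex_halfspace_lt)
  moreover have "x + r *\<^sub>R u \<in> cball x r"
    using u(1) \<open>0 \<le> r\<close> by (simp add: dist_norm)
  moreover have "u \<bullet> u = 1" using u(1) by (simp add: norm_eq_1)
  ultimately show False
    using sub by (fastforce simp: inner_add_right)
next
  assume none: "\<nexists>u. norm u = 1 \<and> (\<forall>y\<in>Y. y \<subseteq> {z. u \<bullet> z < u \<bullet> x + r})"
  show "cball x r \<subseteq> CH Y"
  proof (rule ccontr)
    assume "\<not> ?thesis"
    then obtain z where z: "dist x z \<le> r" "z \<notin> CH Y"
      by (meson mem_cball subsetI)
    have "closed (CH Y)" "convex (CH Y)"
      unfolding CH_def using assms by (simp_all add: compact_Union compact_convex_hull compact_imp_closed)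
    then obtain a b where ab: "a \<bullet> z < b" "\<And>s. s \<in> CH Y \<Longrightarrow> b < a \<bullet> s"
      using separating_hyperplane_closed_point[of "CH Y" z] z(2) by blast
    show False
    proof (cases "a = 0")
      \<comment> \<open>A zero normal separates only from the empty hull, and then every direction
        works.\<close>
      case True
      then have "CH Y = {}" using ab by fastforce
      then have "\<Union>Y = {}" by (simp add: CH_def)
      moreover obtain u :: "real ^ 2" where "norm u = 1"
        using vector_choose_size[of 1] by auto
      ultimately show False using none by blast
    next
      case False
      \<comment> \<open>The normal is reversed and normalised, so that the hull lies strictly below
        \<open>z\<close> in direction \<open>u\<close>.\<close>
      define u where "u = (- inverse (norm a)) *\<^sub>R a"
      have u: "norm u = 1" using False by (simp add: u_def)
      have "u \<bullet> (z - x) \<le> norm u * norm (z - x)" by (rule norm_cauchy_schwarz)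
      also have "\<dots> \<le> r" using z(1) u by (simp add: dist_norm norm_minus_commute)
      finally have zr: "u \<bullet> z \<le> u \<bullet> x + r" by (simp add: inner_diff_right)
      have "u \<bullet> s < u \<bullet> x + r" if "y \<in> Y" "s \<in> y" for y s
      proof -
        have "s \<in> CH Y" unfolding CH_def using that by (auto intro: hull_inc)
        then have "a \<bullet> z < a \<bullet> s" using ab by force
        then have "u \<bullet> s < u \<bullet> z" using False by (simp add: u_def)
        then show ?thesis using zr by simp
      qed
      then show False using none u by blast
    qed
  qed
qed

text \<open>The support function of the disc is \<open>u \<bullet> x + r\<close>, attained at
  \<open>x + r *\<^sub>R u\<close>.\<close>

lemma cball_subset_halfspace_iff:
  fixes u :: "'a :: real_inner"
  assumes "norm u = 1" "0 \<le> r"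
  shows "cball x r \<subseteq> {z. u \<bullet> z < k} \<longleftrightarrow> u \<bullet> x + r < k"
proof
  assume "cball x r \<subseteq> {z. u \<bullet> z < k}"
  moreover have "x + r *\<^sub>R u \<in> cball x r" using assms by (simp add: dist_norm)
  moreover have "u \<bullet> u = 1" using assms by (simp add: norm_eq_1)
  ultimately show "u \<bullet> x + r < k" by (auto simp: inner_add_right)
next
  assume *: "u \<bullet> x + r < k"
  have "u \<bullet> z \<le> u \<bullet> x + r" if "dist x z \<le> r" for z
    using norm_cauchy_schwarz[of u "z - x"] that assms
    by (simp add: inner_diff_right dist_norm norm_minus_commute)
  then show "cball x r \<subseteq> {z. u \<bullet> z < k}" using * by force
qed

section \<open>From tight implications to arcs\<close>

theorem theorem5p1:
  fixes a b c d e :: "(real ^ 2) set"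
  assumes "is_circle a" and "is_circle b" and "is_circle c" and "is_circle d" and "is_circle e"
    and "distinct [a, c, d]" and "distinct [b, c, d]"
    and "tight_implication {a, c, d} e"
    and "tight_implication {b, c, d} e"
  shows "\<not> implication {a, b} e"
proof -
  obtain x r where e: "e = cball x r" "0 \<le> r"
    using \<open>is_circle e\<close> by (auto simp: is_circle_def)
  define N where "N y = {u \<in> sphere 0 1. y \<subseteq> {z. u \<bullet> z < u \<bullet> x + r}}" for y
  have arc: "\<exists>p q. N y = arc_of p q" if circle: "is_circle y" for y
  proof -
    obtain x' r' where y: "y = cball x' r'" "0 \<le> r'"
      using circle by (auto simp: is_circle_def)
    \<comment> \<open>Comparing the two support functions leaves the difference of the centres as
      normal and that of the radii as bound.\<close>
    have "y \<subseteq> {z. u \<bullet> z < u \<bullet> x + r} \<longleftrightarrow> (x' - x) \<bullet> u < r - r'" if "norm u = 1" for u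
      unfolding y(1) cball_subset_halfspace_iff[OF that y(2)]
      by (auto simp: inner_diff_right inner_commute)
    then have "N y = arc_of (x' - x) (r - r')"
      unfolding N_def arc_of_def by (intro Collect_cong) (simp cong: conj_cong)
    then show ?thesis by blast
  qed
  \<comment> \<open>The factor \<open>sphere 0 1\<close> keeps the criterion right for empty
    \<open>Y\<close>, where \<open>\<Inter>\<close> alone is the whole plane.\<close>
  have hull: "e \<subseteq> CH Y \<longleftrightarrow> sphere 0 1 \<inter> \<Inter> (N ` Y) = {}"
    if "finite Y" "\<And>y. y \<in> Y \<Longrightarrow> is_circle y" for Y
  proof -
    have "compact y" if "y \<in> Y" for y
      using \<open>\<And>y. y \<in> Y \<Longrightarrow> is_circle y\<close>[OF that] by (auto simp: is_circle_def)
    note cball_subset_CH_iff[OF \<open>finite Y\<close> this e(2), of x, folded e(1)]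
    moreover have "u \<in> sphere 0 1 \<inter> \<Inter> (N ` Y) \<longleftrightarrow>
        norm u = 1 \<and> (\<forall>y\<in>Y. y \<subseteq> {z. u \<bullet> z < u \<bullet> x + r})" for u
      unfolding N_def by (simp cong: conj_cong)
    ultimately show ?thesis by blast
  qed
  have [simp]: "sphere 0 1 \<inter> (N y \<inter> X) = N y \<inter> X" for y X
    by (auto simp: N_def)
  have tight: "N p \<inter> N c \<inter> N d = {}" "N p \<inter> N c \<noteq> {}" "N p \<inter> N d \<noteq> {}" "N c \<inter> N d \<noteq> {}"
    if "is_circle p" "distinct [p, c, d]" "tight_implication {p, c, d} e" for p
  proof -
    \<comment> \<open>Distinctness ensures that deleting one disc leaves precisely the other two, so
      tightness yields the three pairwise intersections.\<close>
    have "{p, c, d} - {p} = {c, d}" "{p, c, d} - {c} = {p, d}" "{p, c, d} - {d} = {p, c}"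
      using that(2) by auto
    then show "N p \<inter> N c \<inter> N d = {}" "N p \<inter> N c \<noteq> {}" "N p \<inter> N d \<noteq> {}" "N c \<inter> N d \<noteq> {}"
      using that(3) hull[of "{p, c, d}"] hull[of "{c, d}"] hull[of "{p, d}"] hull[of "{p, c}"]
        that(1) \<open>is_circle c\<close> \<open>is_circle d\<close>
      by (auto simp: tight_implication_def implication_def Int_assoc)
  qed
  obtain pa qa pb qb pc qc pd qd where
    "N a = arc_of pa qa" "N b = arc_of pb qb" "N c = arc_of pc qc" "N d = arc_of pd qd"
    using arc assms(1-4) by metis
  from arcs_meet[OF this] tight[OF assms(1,6,8)] tight[OF assms(2,7,9)]
  have "N a \<inter> N b \<noteq> {}" by blast
  then show ?thesis
    using hull[of "{a, b}"] assms(1,2) by (auto simp: implication_def)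
qed

end
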